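(* Let $\mathcal{H}$ be a nonzero complex separable Hilbert space. There is no conjugation $\mathbf{C}$ on $L^2(\mathcal{H})$ such that $\mathbf{C}\mathbf{M}_z=\mathbf{M}_{\bar z}\mathbf{C}$ and $\mathbf{C}(H^2(\mathcal{H}))\subset H^2(\mathcal{H})$.
   Context: $\mathbb{T}$ is the unit circle with normalized Lebesgue measure $m$. A conjugation on a Hilbert space $\mathcal{K}$ is an antilinear map $C:\mathcal{K}\to\mathcal{K}$ with $C^2=I$ and $\langle Cf,Cg\rangle=\langle g,f\rangle$ for all $f,g$. $L^2(\mathcal{H})$ is the Hilbert space of (classes of) measurable square-integrable $\mathbf{f}:\mathbb{T}\to\mathcal{H}$ with inner product $\int_{\mathbb{T}}\langle\mathbf{f}(z),\mathbf{g}(z)\rangle dm(z)$; every $\mathbf{f}\in L^2(\mathcal{H})$ has a Fourier expansion $\mathbf{f}=\sum_{n\in\mathbb{Z}}x_ne_n$ with $x_n\in\mathcal{H}$, $e_n(z)=z^n$, and $H^2(\mathcal{H})$ is the closed subspace of those $\mathbf{f}$ with $x_n=0$ for $n<0$. $(\mathbf{M}_z\mathbf{f})(z)=z\mathbf{f}(z)$ and $(\mathbf{M}_{\bar z}\mathbf{f})(z)=\bar z\mathbf{f}(z)$. *)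

theory Defs
  imports "HOL-Analysis.Analysis"
begin

section \<open>Complex Hilbert spaces and conjugations\<close>

text \<open>The inner product is linear in its first argument. The norm, and with it completeness, is
  inherited from \<^class>\<open>real_inner\<close>, whose inner product is required to be the real part of the
  complex one.\<close>

class complex_inner = real_inner +
  fixes scaleC :: "complex \<Rightarrow> 'a \<Rightarrow> 'a"  (infixr "*\<^sub>C" 75)
    and cinner :: "'a \<Rightarrow> 'a \<Rightarrow> complex"
  assumes scaleC_add_right: "a *\<^sub>C (x + y) = a *\<^sub>C x + a *\<^sub>C y"
    and scaleC_add_left: "(a + b) *\<^sub>C x = a *\<^sub>C x + b *\<^sub>C x"
    and scaleC_scaleC: "a *\<^sub>C b *\<^sub>C x = (a * b) *\<^sub>C x"
    and scaleC_of_real: "complex_of_real r *\<^sub>C x = scaleR r x"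
    and cinner_commute: "cinner x y = cnj (cinner y x)"
    and cinner_add_left: "cinner (x + y) z = cinner x z + cinner y z"
    and cinner_scaleC_left: "cinner (a *\<^sub>C x) y = a * cinner x y"
    and inner_eq_Re_cinner: "inner x y = Re (cinner x y)"

class complex_hilbert = complex_inner + complete_space

subclass (in complex_hilbert) banach ..

instantiation complex :: complex_hilbert
begin

definition "scaleC_complex = ((*) :: complex \<Rightarrow> complex \<Rightarrow> complex)"
definition "cinner_complex (x :: complex) y = x * cnj y"

instance
  by standard (auto simp: scaleC_complex_def cinner_complex_def algebra_simps scaleR_conv_of_real
      inner_complex_def)

end

definition conjugation :: "('a::complex_hilbert \<Rightarrow> 'a) \<Rightarrow> bool" where
  "conjugation C \<longleftrightarrow>
     (\<forall>x y. C (x + y) = C x + C y) \<and>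
     (\<forall>a x. C (a *\<^sub>C x) = cnj a *\<^sub>C C x) \<and>
     (\<forall>x. C (C x) = x) \<and>
     (\<forall>x y. cinner (C x) (C y) = cinner y x)"

context complex_inner
begin

lemma scaleC_one [simp]: "1 *\<^sub>C x = x"
  using scaleC_of_real[of 1 x] by (simp only: of_real_1 scaleR_one)

lemma cinner_add_right: "cinner x (y + z) = cinner x y + cinner x z"
  by (metis cinner_add_left cinner_commute complex_cnj_add)

lemma cinner_scaleC_right: "cinner x (a *\<^sub>C y) = cnj a * cinner x y"
  by (metis cinner_scaleC_left cinner_commute complex_cnj_mult)

lemma Im_cinner: "Im (cinner x y) = inner x (\<i> *\<^sub>C y)"
  by (simp add: inner_eq_Re_cinner cinner_scaleC_right)

lemma cinner_self: "cinner x x = complex_of_real (inner x x)"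
proof -
  have "Im (cinner x x) = 0"
    using arg_cong[OF cinner_commute[of x x], of Im] by simp
  then show ?thesis
    by (simp add: complex_eq_iff inner_eq_Re_cinner)
qed

end

lemma norm_scaleC [simp]:
  fixes x :: "'a::complex_inner"
  shows "norm (a *\<^sub>C x) = norm a * norm x"
proof -
  have "cinner (a *\<^sub>C x) (a *\<^sub>C x) = (a * cnj a) * cinner x x"
    by (simp add: cinner_scaleC_left cinner_scaleC_right)
  then have "inner (a *\<^sub>C x) (a *\<^sub>C x) = (norm a)\<^sup>2 * inner x x"
    by (simp add: cinner_self complex_norm_square[symmetric] flip: of_real_mult of_real_power)
  then show ?thesis
    by (simp add: norm_eq_sqrt_inner real_sqrt_mult)
qed

lemma bounded_bilinear_scaleC:
  "bounded_bilinear (scaleC :: complex \<Rightarrow> 'a::complex_inner \<Rightarrow> 'a)"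
proof
  fix a b :: complex and x y :: 'a and r :: real
  show "(a + b) *\<^sub>C x = a *\<^sub>C x + b *\<^sub>C x" by (rule scaleC_add_left)
  show "a *\<^sub>C (x + y) = a *\<^sub>C x + a *\<^sub>C y" by (rule scaleC_add_right)
  show "scaleR r a *\<^sub>C x = scaleR r (a *\<^sub>C x)"
    by (simp add: scaleR_conv_of_real scaleC_scaleC flip: scaleC_of_real)
  show "a *\<^sub>C scaleR r x = scaleR r (a *\<^sub>C x)"
    by (simp add: scaleC_scaleC mult.commute flip: scaleC_of_real)
  show "\<exists>K. \<forall>a (x::'a). norm (a *\<^sub>C x) \<le> norm a * norm x * K"
    by (rule exI[of _ 1]) simp
qed

lemma bounded_bilinear_cinner:
  "bounded_bilinear (cinner :: 'a::complex_inner \<Rightarrow> 'a \<Rightarrow> complex)"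
proof
  fix x y z :: 'a and r :: real
  show "cinner (x + y) z = cinner x z + cinner y z" by (rule cinner_add_left)
  show "cinner x (y + z) = cinner x y + cinner x z" by (rule cinner_add_right)
  show "cinner (scaleR r x) y = scaleR r (cinner x y)"
    by (simp add: cinner_scaleC_left scaleR_conv_of_real flip: scaleC_of_real)
  show "cinner x (scaleR r y) = scaleR r (cinner x y)"
    by (simp add: cinner_scaleC_right scaleR_conv_of_real flip: scaleC_of_real)
  have "norm (cinner x y) \<le> norm x * norm y * 2" for x y :: 'a
  proof -
    have "norm (cinner x y) \<le> \<bar>Re (cinner x y)\<bar> + \<bar>Im (cinner x y)\<bar>"
      by (rule cmod_le)
    also have "\<dots> \<le> norm x * norm y + norm x * norm (\<i> *\<^sub>C y)"
      unfolding inner_eq_Re_cinner[symmetric] Im_cinner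
      by (intro add_mono Cauchy_Schwarz_ineq2)
    finally show ?thesis by simp
  qed
  then show "\<exists>K. \<forall>(x::'a) y. norm (cinner x y) \<le> norm x * norm y * K" by blast
qed

lemma borel_measurable_scaleC [measurable (raw)]:
  fixes f :: "'b \<Rightarrow> 'a::{complex_inner, second_countable_topology}"
  assumes "c \<in> borel_measurable M" "f \<in> borel_measurable M"
  shows "(\<lambda>x. c x *\<^sub>C f x) \<in> borel_measurable M"
  using assms
  by (rule borel_measurable_continuous_Pair)
     (intro bounded_bilinear.continuous_on[OF bounded_bilinear_scaleC] continuous_intros)

lemma borel_measurable_cinner [measurable (raw)]:
  fixes f g :: "'b \<Rightarrow> 'a::{complex_inner, second_countable_topology}"
  assumes "f \<in> borel_measurable M" "g \<in> borel_measurable M"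
  shows "(\<lambda>x. cinner (f x) (g x)) \<in> borel_measurable M"
  using assms
  by (rule borel_measurable_continuous_Pair)
     (intro bounded_bilinear.continuous_on[OF bounded_bilinear_cinner] continuous_intros)

section \<open>The space of square-integrable functions on the unit circle\<close>

text \<open>Normalized arc length, on the Borel sets of the unit circle. Functions in \<open>L2\<close> below are total
  functions on the complex plane, but only their values on the circle matter. Every Lebesgue
  measurable function is a.e. equal to a Borel measurable one, and for a separable range Borel
  measurability is strong measurability, so the quotient is the usual space of classes.\<close>

definition circle :: "complex measure" where
  "circle = distr (uniform_measure lborel {0..<2 * pi}) (restrict_space borel (sphere 0 1)) cis"

lemma space_circle: "space circle = sphere 0 1"
  by (simp add: circle_def space_restrict_space)

lemma sets_circle [measurable_cong]: "sets circle = sets (restrict_space borel (sphere 0 1))"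
  by (simp add: circle_def)

lemma emeasure_space_circle: "emeasure circle (space circle) = 1"
proof -
  have [measurable]: "cis \<in> borel_measurable borel"
    by (intro borel_measurable_continuous_onI continuous_intros)
  have "cis \<in> measurable (uniform_measure lborel {0..<2 * pi}) (restrict_space borel (sphere 0 1))"
    by (rule measurable_restrict_space2) (auto simp: space_restrict_space)
  moreover have "cis -` sphere 0 1 = UNIV" by auto
  moreover have "sphere 0 1 \<in> sets (restrict_space borel (sphere 0 1 :: complex set))"
    by (metis sets.top space_borel space_restrict_space2 sets.top borel_closed closed_sphere)
  ultimately show ?thesis
    by (simp add: circle_def emeasure_distr space_restrict_space emeasure_uniform_measure)
qed

lemma measurable_circle_ident [measurable]: "(\<lambda>z. z) \<in> borel_measurable circle"
  by (simp add: measurable_cong_sets[OF sets_circle refl] measurable_restrict_space1)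

lemma borel_measurable_cnj [measurable]: "cnj \<in> borel_measurable borel"
  by (intro borel_measurable_continuous_onI continuous_intros)

lemma measurable_circle_cnj [measurable]: "cnj \<in> borel_measurable circle"
  by (rule measurable_compose[OF measurable_circle_ident borel_measurable_cnj])

lemma measurable_circle_powi [measurable]: "(\<lambda>z. z powi n) \<in> borel_measurable circle"
  by (auto simp: power_int_def)

definition square_integrable :: "(complex \<Rightarrow> 'h::{complex_hilbert, second_countable_topology}) \<Rightarrow> bool"
  where "square_integrable f \<longleftrightarrow>
    f \<in> borel_measurable circle \<and> integrable circle (\<lambda>z. (norm (f z))\<^sup>2)"

lemma square_integrable_measurable: "square_integrable f \<Longrightarrow> f \<in> borel_measurable circle"
  by (simp add: square_integrable_def)

lemma square_integrable_zero: "square_integrable (\<lambda>z. 0)"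
  by (simp add: square_integrable_def)

lemma square_integrable_add:
  assumes "square_integrable f" "square_integrable g"
  shows "square_integrable (\<lambda>z. f z + g z)"
proof -
  have [measurable]: "f \<in> borel_measurable circle" "g \<in> borel_measurable circle"
    using assms by (auto simp: square_integrable_def)
  have bound: "(norm (f z + g z))\<^sup>2 \<le> 2 * (norm (f z))\<^sup>2 + 2 * (norm (g z))\<^sup>2" for z
  proof -
    have "(norm (f z + g z))\<^sup>2 \<le> (norm (f z) + norm (g z))\<^sup>2"
      by (intro power_mono norm_triangle_ineq) auto
    also have "\<dots> \<le> 2 * (norm (f z))\<^sup>2 + 2 * (norm (g z))\<^sup>2"
      using sum_squares_bound[of "norm (f z)" "norm (g z)"] by (simp add: power2_sum)
    finally show ?thesis .
  qed
  have "integrable circle (\<lambda>z. 2 * (norm (f z))\<^sup>2 + 2 * (norm (g z))\<^sup>2)"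
    using assms by (auto simp: square_integrable_def)
  then have "integrable circle (\<lambda>z. (norm (f z + g z))\<^sup>2)"
    by (rule Bochner_Integration.integrable_bound) (use bound in auto)
  then show ?thesis by (simp add: square_integrable_def)
qed

lemma square_integrable_scaleC_bounded:
  assumes "square_integrable f" and [measurable]: "c \<in> borel_measurable circle"
    and c: "\<And>z. z \<in> space circle \<Longrightarrow> norm (c z) \<le> B"
  shows "square_integrable (\<lambda>z. c z *\<^sub>C f z)"
proof -
  have [measurable]: "f \<in> borel_measurable circle"
    using assms by (auto simp: square_integrable_def)
  have "integrable circle (\<lambda>z. B\<^sup>2 * (norm (f z))\<^sup>2)"
    using assms by (auto simp: square_integrable_def)
  then have "integrable circle (\<lambda>z. (norm (c z *\<^sub>C f z))\<^sup>2)"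
    by (rule Bochner_Integration.integrable_bound)
       (auto simp: power_mult_distrib intro!: AE_I2 mult_right_mono power_mono c)
  then show ?thesis by (simp add: square_integrable_def)
qed

lemma square_integrable_scaleC: "square_integrable f \<Longrightarrow> square_integrable (\<lambda>z. a *\<^sub>C f z)"
  by (rule square_integrable_scaleC_bounded[where B = "norm a"]) auto

lemma square_integrable_scaleR: "square_integrable f \<Longrightarrow> square_integrable (\<lambda>z. scaleR r (f z))"
  using square_integrable_scaleC[of f "complex_of_real r"] by (simp add: scaleC_of_real)

lemma square_integrable_uminus: "square_integrable f \<Longrightarrow> square_integrable (\<lambda>z. - f z)"
  by (simp add: square_integrable_def)

lemma square_integrable_diff:
  "square_integrable f \<Longrightarrow> square_integrable g \<Longrightarrow> square_integrable (\<lambda>z. f z - g z)"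
  using square_integrable_add[of f "\<lambda>z. - g z"] square_integrable_uminus[of g] by simp

lemma integrable_cinner:
  assumes "square_integrable f" "square_integrable g"
  shows "integrable circle (\<lambda>z. cinner (f z) (g z))"
proof -
  have [measurable]: "f \<in> borel_measurable circle" "g \<in> borel_measurable circle"
    using assms by (auto simp: square_integrable_def)
  obtain K where K: "0 \<le> K" "\<And>x y :: 'a. norm (cinner x y) \<le> norm x * norm y * K"
    using bounded_bilinear.nonneg_bounded[OF bounded_bilinear_cinner] by blast
  have bound: "norm (cinner (f z) (g z)) \<le> K * ((norm (f z))\<^sup>2 + (norm (g z))\<^sup>2)" for z
  proof -
    have "norm (f z) * norm (g z) \<le> (norm (f z))\<^sup>2 + (norm (g z))\<^sup>2"
      using sum_squares_bound[of "norm (f z)" "norm (g z)"]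
        mult_nonneg_nonneg[OF norm_ge_zero[of "f z"] norm_ge_zero[of "g z"]] by linarith
    then have "norm (f z) * norm (g z) * K \<le> ((norm (f z))\<^sup>2 + (norm (g z))\<^sup>2) * K"
      by (rule mult_right_mono) (rule K)
    with K(2)[of "f z" "g z"] show ?thesis by (simp add: mult.commute)
  qed
  have "integrable circle (\<lambda>z. K * ((norm (f z))\<^sup>2 + (norm (g z))\<^sup>2))"
    using assms by (auto simp: square_integrable_def)
  then show ?thesis
    by (rule Bochner_Integration.integrable_bound)
       (use bound K in \<open>auto intro: order_trans[OF _ abs_ge_self]\<close>)
qed

definition L2_rel ::
    "(complex \<Rightarrow> 'h::{complex_hilbert, second_countable_topology}) \<Rightarrow> (complex \<Rightarrow> 'h) \<Rightarrow> bool" where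
  "L2_rel f g \<longleftrightarrow> square_integrable f \<and> square_integrable g \<and> (AE z in circle. f z = g z)"

quotient_type (overloaded) 'h L2 =
  "complex \<Rightarrow> 'h::{complex_hilbert, second_countable_topology}" / partial: L2_rel
proof (rule part_equivpI)
  show "\<exists>f::complex \<Rightarrow> 'h. L2_rel f f"
    using square_integrable_zero by (auto simp: L2_rel_def)
  show "symp (L2_rel :: (complex \<Rightarrow> 'h) \<Rightarrow> _)"
    by (auto simp: symp_def L2_rel_def)
  show "transp (L2_rel :: (complex \<Rightarrow> 'h) \<Rightarrow> _)"
    by (auto simp: transp_def L2_rel_def elim: AE_mp)
qed

instantiation L2 :: ("{complex_hilbert, second_countable_topology}") complex_inner
begin

lift_definition zero_L2 :: "'a L2" is "\<lambda>z. 0"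
  by (simp add: L2_rel_def square_integrable_zero)

lift_definition plus_L2 :: "'a L2 \<Rightarrow> 'a L2 \<Rightarrow> 'a L2" is "\<lambda>f g z. f z + g z"
  by (auto simp: L2_rel_def square_integrable_add)

lift_definition uminus_L2 :: "'a L2 \<Rightarrow> 'a L2" is "\<lambda>f z. - f z"
  by (auto simp: L2_rel_def square_integrable_uminus)

lift_definition minus_L2 :: "'a L2 \<Rightarrow> 'a L2 \<Rightarrow> 'a L2" is "\<lambda>f g z. f z - g z"
  by (auto simp: L2_rel_def square_integrable_diff)

lift_definition scaleR_L2 :: "real \<Rightarrow> 'a L2 \<Rightarrow> 'a L2" is "\<lambda>r f z. scaleR r (f z)"
  by (auto simp: L2_rel_def square_integrable_scaleR)

lift_definition scaleC_L2 :: "complex \<Rightarrow> 'a L2 \<Rightarrow> 'a L2" is "\<lambda>a f z. a *\<^sub>C f z"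
  by (auto simp: L2_rel_def square_integrable_scaleC)

lift_definition cinner_L2 :: "'a L2 \<Rightarrow> 'a L2 \<Rightarrow> complex"
  is "\<lambda>f g. \<integral>z. cinner (f z) (g z) \<partial>circle"
proof -
  fix f f' g g' :: "complex \<Rightarrow> 'a"
  assume "L2_rel f f'" "L2_rel g g'"
  then have [measurable]: "f \<in> borel_measurable circle" "f' \<in> borel_measurable circle"
      "g \<in> borel_measurable circle" "g' \<in> borel_measurable circle"
    and "AE z in circle. f z = f' z" "AE z in circle. g z = g' z"
    by (auto simp: L2_rel_def square_integrable_def)
  then have "AE z in circle. cinner (f z) (g z) = cinner (f' z) (g' z)" by auto
  then show "(\<integral>z. cinner (f z) (g z) \<partial>circle) = (\<integral>z. cinner (f' z) (g' z) \<partial>circle)"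
    by (intro integral_cong_AE) auto
qed

definition "inner_L2 (f :: 'a L2) g = Re (cinner f g)"
definition "norm_L2 (f :: 'a L2) = sqrt (inner f f)"
definition "dist_L2 (f :: 'a L2) g = norm (f - g)"
definition "sgn_L2 (f :: 'a L2) = scaleR (inverse (norm f)) f"
definition "uniformity_L2 = (INF e\<in>{0<..}. principal {(f :: 'a L2, g). dist f g < e})"
definition "open_L2 (U :: 'a L2 set) \<longleftrightarrow>
  (\<forall>f\<in>U. \<forall>\<^sub>F (f', g) in uniformity. f' = f \<longrightarrow> g \<in> U)"

instance
proof
  fix f g h :: "'a L2" and a b :: complex and r s :: real and U :: "'a L2 set"
  note si = L2_rel_def square_integrable_zero square_integrable_add square_integrable_diff
    square_integrable_uminus square_integrable_scaleC square_integrable_scaleR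
  show "f + g + h = f + (g + h)" by transfer (auto simp: si algebra_simps)
  show "f + g = g + f" by transfer (auto simp: si algebra_simps)
  show "0 + f = f" by transfer (auto simp: si)
  show "- f + f = 0" by transfer (auto simp: si)
  show "f - g = f + - g" by transfer (auto simp: si)
  show "scaleR r (f + g) = scaleR r f + scaleR r g" by transfer (auto simp: si algebra_simps)
  show "scaleR (r + s) f = scaleR r f + scaleR s f" by transfer (auto simp: si algebra_simps)
  show "scaleR r (scaleR s f) = scaleR (r * s) f" by transfer (auto simp: si)
  show "scaleR 1 f = f" by transfer (auto simp: si)
  show "a *\<^sub>C (f + g) = a *\<^sub>C f + a *\<^sub>C g"
    by transfer (auto simp: si scaleC_add_right)
  show "(a + b) *\<^sub>C f = a *\<^sub>C f + b *\<^sub>C f"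
    by transfer (auto simp: si scaleC_add_left)
  show "a *\<^sub>C b *\<^sub>C f = (a * b) *\<^sub>C f"
    by transfer (auto simp: si scaleC_scaleC)
  show "complex_of_real r *\<^sub>C f = scaleR r f"
    by transfer (auto simp: si scaleC_of_real)
  show comm: "cinner f g = cnj (cinner g f)" for f g :: "'a L2"
  proof transfer
    fix f g :: "complex \<Rightarrow> 'a"
    have "(\<integral>z. cinner (f z) (g z) \<partial>circle) = (\<integral>z. cnj (cinner (g z) (f z)) \<partial>circle)"
      by (simp flip: cinner_commute)
    then show "(\<integral>z. cinner (f z) (g z) \<partial>circle) = cnj (\<integral>z. cinner (g z) (f z) \<partial>circle)"
      by simp
  qed
  show add: "cinner (f + g) h = cinner f h + cinner g h" for f g h :: "'a L2"
    by transfer (auto simp: L2_rel_def cinner_add_left integrable_cinner)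
  show "cinner (a *\<^sub>C f) g = a * cinner f g"
    by transfer (auto simp: L2_rel_def cinner_scaleC_left)
  show scR: "inner (scaleR r f) g = r * inner f g"
    unfolding inner_L2_def
    by transfer (auto simp: cinner_scaleC_left simp flip: scaleC_of_real)
  show "inner f g = Re (cinner f g)" by (rule inner_L2_def)
  show "inner f g = inner g f"
    unfolding inner_L2_def by (subst comm) simp
  show "inner (f + g) h = inner f h + inner g h"
    unfolding inner_L2_def by (simp add: add)
  show "0 \<le> inner f f"
    unfolding inner_L2_def by transfer (simp add: cinner_self)
  show "inner f f = 0 \<longleftrightarrow> f = 0"
    unfolding inner_L2_def
  proof transfer
    fix f :: "complex \<Rightarrow> 'a"
    assume "L2_rel f f"
    then have f: "square_integrable f" by (simp add: L2_rel_def)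
    have "Re (\<integral>z. cinner (f z) (f z) \<partial>circle) = (\<integral>z. (norm (f z))\<^sup>2 \<partial>circle)"
      by (simp add: cinner_self power2_norm_eq_inner)
    also have "\<dots> = 0 \<longleftrightarrow> (AE z in circle. f z = 0)"
      using f by (subst integral_nonneg_eq_0_iff_AE) (auto simp: square_integrable_def)
    finally show "Re (\<integral>z. cinner (f z) (f z) \<partial>circle) = 0 \<longleftrightarrow> L2_rel f (\<lambda>z. 0)"
      using f by (simp add: L2_rel_def square_integrable_zero)
  qed
  show "norm f = sqrt (inner f f)" by (rule norm_L2_def)
  show "dist f g = norm (f - g)" by (rule dist_L2_def)
  show "sgn f = scaleR (inverse (norm f)) f" by (rule sgn_L2_def)
  show "(uniformity :: ('a L2 \<times> 'a L2) filter) = (INF e\<in>{0<..}. principal {(f, g). dist f g < e})"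
    by (rule uniformity_L2_def)
  show "open U \<longleftrightarrow> (\<forall>f\<in>U. \<forall>\<^sub>F (f', g) in uniformity. f' = f \<longrightarrow> g \<in> U)"
    by (rule open_L2_def)
qed

end

lemma ex_abs_L2: "\<exists>f. square_integrable f \<and> F = abs_L2 f"
  by (induction F rule: L2.abs_induct) (auto simp: L2_rel_def)

lemma minus_abs_L2:
  "square_integrable f \<Longrightarrow> square_integrable g \<Longrightarrow> abs_L2 f - abs_L2 g = abs_L2 (\<lambda>z. f z - g z)"
  by (simp add: minus_L2.abs_eq L2_rel_def)

lemma norm_abs_L2:
  assumes "square_integrable f"
  shows "ennreal ((norm (abs_L2 f))\<^sup>2) = (\<integral>\<^sup>+z. ennreal ((norm (f z))\<^sup>2) \<partial>circle)"
proof -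
  have "(norm (abs_L2 f))\<^sup>2 = Re (\<integral>z. cinner (f z) (f z) \<partial>circle)"
    using assms
    by (simp add: power2_norm_eq_inner inner_L2_def cinner_L2.abs_eq L2_rel_def)
  also have "\<dots> = (\<integral>z. (norm (f z))\<^sup>2 \<partial>circle)"
    by (simp add: cinner_self power2_norm_eq_inner)
  finally show ?thesis
    using assms by (subst nn_integral_eq_integral) (auto simp: square_integrable_def)
qed

instance L2 :: ("{complex_hilbert, second_countable_topology}") complex_hilbert
proof
  fix X :: "nat \<Rightarrow> 'a L2"
  assume X: "Cauchy X"
  have ex: "\<exists>N. \<forall>m\<ge>N. \<forall>n\<ge>N. dist (X m) (X n) < (1/2)^k" for k :: nat
    using X unfolding Cauchy_def by simp
  define N where "N k = (SOME N. \<forall>m\<ge>N. \<forall>n\<ge>N. dist (X m) (X n) < (1/2)^k)" for k :: nat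
  have N: "dist (X m) (X n) < (1/2)^k" if "m \<ge> N k" "n \<ge> N k" for m n k
    using someI_ex[OF ex[of k]] that unfolding N_def by blast
  define r where "r = rec_nat (N 0) (\<lambda>k p. max (Suc p) (N (Suc k)))"
  have r_Suc: "r (Suc k) = max (Suc (r k)) (N (Suc k))" for k by (simp add: r_def)
  have r: "strict_mono r" unfolding strict_mono_Suc_iff by (simp add: r_Suc less_max_iff_disj)
  have rN: "N k \<le> r k" for k by (cases k) (auto simp: r_def)
  have dist_r: "dist (X (r m)) (X (r n)) \<le> (1/2)^k" if "k \<le> m" "k \<le> n" for k m n
    using N[of k "r m" "r n"] rN[of k] strict_mono_leD[OF r] that
    by (meson order.trans less_imp_le)
  define F where "F n = (SOME f. square_integrable f \<and> X n = abs_L2 f)" for n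
  have F: "square_integrable (F n)" "X n = abs_L2 (F n)" for n
    using someI_ex[OF ex_abs_L2[of "X n"]] unfolding F_def by blast+
  define f where "f n = F (r n)" for n
  have f: "square_integrable (f n)" "X (r n) = abs_L2 (f n)" for n
    using F by (auto simp: f_def)
  have [measurable]: "f n \<in> borel_measurable circle" for n
    using f(1) by (rule square_integrable_measurable)
  have nn: "(\<integral>\<^sup>+z. ennreal ((norm (f m z - f n z))\<^sup>2) \<partial>circle) \<le> ennreal (((1/2)^k)\<^sup>2)"
    if "k \<le> m" "k \<le> n" for m n k
  proof -
    have "(dist (X (r m)) (X (r n)))\<^sup>2 \<le> ((1/2)^k)\<^sup>2"
      by (intro power_mono dist_r that) auto
    then show ?thesis
      using f by (simp add: dist_norm minus_abs_L2 square_integrable_diff ennreal_leI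
          flip: norm_abs_L2)
  qed
  have nn1: "(\<integral>\<^sup>+z. ennreal (norm (f (Suc n) z - f n z)) \<partial>circle) \<le> ennreal ((1/2)^n)" for n
  proof -
    define e where "e = ((1/2)^n :: real)"
    have e: "e > 0" by (simp add: e_def)
    have comb: "ennreal (e / 2) + ennreal (1 / (2 * e)) * ennreal b = ennreal (e / 2 + b / (2 * e))"
      if "b \<ge> 0" for b
      using e that by (subst ennreal_mult[symmetric]) (auto simp flip: ennreal_plus)
    have le: "ennreal a \<le> ennreal (e / 2) + ennreal (1 / (2 * e)) * ennreal (a\<^sup>2)" for a
    proof -
      have "0 \<le> (a - e)\<^sup>2 / (2 * e)" using e by simp
      also have "\<dots> = e / 2 + a\<^sup>2 / (2 * e) - a"
        using e by (simp add: field_simps power2_eq_square)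
      finally have "a \<le> e / 2 + a\<^sup>2 / (2 * e)" by simp
      then show ?thesis by (simp add: comb ennreal_leI)
    qed
    have "(\<integral>\<^sup>+z. ennreal (norm (f (Suc n) z - f n z)) \<partial>circle)
        \<le> (\<integral>\<^sup>+z. ennreal (e / 2) + ennreal (1 / (2 * e)) *
              ennreal ((norm (f (Suc n) z - f n z))\<^sup>2) \<partial>circle)"
      by (intro nn_integral_mono le)
    also have "\<dots> = ennreal (e / 2) + ennreal (1 / (2 * e)) *
        (\<integral>\<^sup>+z. ennreal ((norm (f (Suc n) z - f n z))\<^sup>2) \<partial>circle)"
      by (subst nn_integral_add) (auto simp: nn_integral_cmult emeasure_space_circle)
    also have "\<dots> \<le> ennreal (e / 2) + ennreal (1 / (2 * e)) * ennreal (e\<^sup>2)"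
      unfolding e_def by (intro add_left_mono mult_left_mono nn) auto
    also have "\<dots> = ennreal ((1/2)^n)"
      using e unfolding comb[OF zero_le_power2] by (simp add: power2_eq_square field_simps e_def)
    finally show ?thesis .
  qed
  have "(\<integral>\<^sup>+z. (\<Sum>n. ennreal (norm (f (Suc n) z - f n z))) \<partial>circle)
      = (\<Sum>n. \<integral>\<^sup>+z. ennreal (norm (f (Suc n) z - f n z)) \<partial>circle)"
    by (rule nn_integral_suminf) simp
  also have "\<dots> \<le> (\<Sum>n. ennreal ((1/2)^n))"
    by (intro suminf_le nn1) auto
  also have "\<dots> = ennreal (\<Sum>n. (1/2)^n)"
    by (intro suminf_ennreal2) (auto simp: summable_geometric)
  also have "\<dots> < \<infinity>" by simp
  finally have "AE z in circle. (\<Sum>n. ennreal (norm (f (Suc n) z - f n z))) \<noteq> \<infinity>"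
    by (intro nn_integral_PInf_AE) auto
  then have conv: "AE z in circle. (\<lambda>n. f n z) \<longlonglongrightarrow> lim (\<lambda>n. f n z)"
  proof eventually_elim
    case (elim z)
    then have "summable (\<lambda>n. norm (f (Suc n) z - f n z))"
      by (intro summable_suminf_not_top) auto
    then have "summable (\<lambda>n. f (Suc n) z - f n z)"
      by (rule summable_norm_cancel)
    then have "convergent (\<lambda>n. \<Sum>i<n. f (Suc i) z - f i z)"
      by (simp add: summable_iff_convergent)
    then have "convergent (\<lambda>n. f n z - f 0 z)"
      by (simp add: sum_lessThan_telescope[of "\<lambda>i. f i z"])
    then have "convergent (\<lambda>n. f n z)"
      using convergent_diff_const_right_iff by fastforce
    then show ?case by (simp add: convergent_LIMSEQ_iff)
  qed
  define g where "g z = lim (\<lambda>n. f n z)" for z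
  have [measurable]: "g \<in> borel_measurable circle" unfolding g_def by measurable
  have gn: "(\<integral>\<^sup>+z. ennreal ((norm (g z - f n z))\<^sup>2) \<partial>circle) \<le> ennreal (((1/2)^n)\<^sup>2)" for n
  proof -
    have "(\<integral>\<^sup>+z. ennreal ((norm (g z - f n z))\<^sup>2) \<partial>circle)
        = (\<integral>\<^sup>+z. liminf (\<lambda>m. ennreal ((norm (f m z - f n z))\<^sup>2)) \<partial>circle)"
    proof (rule nn_integral_cong_AE, use conv in eventually_elim)
      case (elim z)
      then have "(\<lambda>m. ennreal ((norm (f m z - f n z))\<^sup>2)) \<longlonglongrightarrow> ennreal ((norm (g z - f n z))\<^sup>2)"
        unfolding g_def by (intro tendsto_intros)
      then show ?case by (intro lim_imp_Liminf[symmetric]) auto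
    qed
    also have "\<dots> \<le> liminf (\<lambda>m. \<integral>\<^sup>+z. ennreal ((norm (f m z - f n z))\<^sup>2) \<partial>circle)"
      by (rule nn_integral_liminf) simp
    also have "\<dots> \<le> liminf (\<lambda>m. ennreal (((1/2)^n)\<^sup>2))"
      by (rule Liminf_mono) (rule eventually_sequentiallyI[of n], rule nn, auto)
    finally show ?thesis by (simp add: Liminf_const)
  qed
  have "square_integrable (\<lambda>z. g z - f 0 z)"
    using gn[of 0] by (auto simp: square_integrable_def integrable_iff_bounded
        intro: le_less_trans)
  from square_integrable_add[OF this f(1)[of 0]] have g: "square_integrable g" by simp
  have "dist (X (r n)) (abs_L2 g) \<le> (1/2)^n" for n
  proof -
    have "ennreal ((norm (abs_L2 g - abs_L2 (f n)))\<^sup>2) \<le> ennreal (((1/2)^n)\<^sup>2)"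
      using gn[of n] g f by (simp add: minus_abs_L2 norm_abs_L2 square_integrable_diff)
    then have "(norm (abs_L2 g - abs_L2 (f n)))\<^sup>2 \<le> ((1/2)^n)\<^sup>2" by simp
    then have "norm (abs_L2 g - abs_L2 (f n)) \<le> (1/2)^n"
      by (rule power2_le_imp_le) simp
    then show ?thesis
      unfolding f(2) dist_norm by (subst norm_minus_commute)
  qed
  then have "(\<lambda>n. dist (X (r n)) (abs_L2 g)) \<longlonglongrightarrow> 0"
    by (intro Lim_null_comparison[OF _ LIMSEQ_realpow_zero[of "1/2"]] always_eventually) auto
  then have "(X \<circ> r) \<longlonglongrightarrow> abs_L2 g"
    unfolding o_def by (rule tendsto_dist_iff[THEN iffD2])
  then have "X \<longlonglongrightarrow> abs_L2 g"
    by (rule Cauchy_converges_subseq[OF X r])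
  then show "convergent X" by (auto simp: convergent_def)
qed

section \<open>Multiplication operators and the Hardy space\<close>

lift_definition M_z :: "'h::{complex_hilbert, second_countable_topology} L2 \<Rightarrow> 'h L2"
  is "\<lambda>f z. z *\<^sub>C f z"
  by (auto simp: L2_rel_def space_circle intro!: square_integrable_scaleC_bounded[where B = 1])

lift_definition M_zbar :: "'h::{complex_hilbert, second_countable_topology} L2 \<Rightarrow> 'h L2"
  is "\<lambda>f z. cnj z *\<^sub>C f z"
  by (auto simp: L2_rel_def space_circle intro!: square_integrable_scaleC_bounded[where B = 1])

text \<open>The coefficient \<open>x\<^sub>n\<close> in the Fourier expansion of \<open>f\<close> with respect to \<open>e\<^sub>n z = z\<^sup>n\<close>.
  The Bochner integral exists because the measure is finite, so that \<open>f\<close> is integrable.\<close>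

lift_definition fourier_coeff :: "'h::{complex_hilbert, second_countable_topology} L2 \<Rightarrow> int \<Rightarrow> 'h"
  is "\<lambda>f n. \<integral>z. cnj (z powi n) *\<^sub>C f z \<partial>circle"
proof
  fix f g :: "complex \<Rightarrow> 'h" and n :: int
  assume "L2_rel f g"
  then have [measurable]: "f \<in> borel_measurable circle" "g \<in> borel_measurable circle"
    and "AE z in circle. f z = g z"
    by (auto simp: L2_rel_def square_integrable_def)
  then show "(\<integral>z. cnj (z powi n) *\<^sub>C f z \<partial>circle) = (\<integral>z. cnj (z powi n) *\<^sub>C g z \<partial>circle)"
    by (intro integral_cong_AE) (auto simp del: complex_cnj_power_int)
qed

definition H2 :: "'h::{complex_hilbert, second_countable_topology} L2 set" where
  "H2 = {f. \<forall>n<0. fourier_coeff f n = 0}"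

end

theory Submission
  imports Defs
begin

text \<open>The subspace \<^const>\<open>H2\<close> is invariant under \<^const>\<open>M_z\<close> but not under \<^const>\<open>M_zbar\<close>:
  multiplication by \<open>z\<close> shifts Fourier coefficients up by one (\<open>fourier_coeff_M_z\<close>), multiplication
  by its conjugate shifts them down (\<open>fourier_coeff_M_zbar\<close>) and so pushes the constant term of a
  function to position \<open>-1\<close>. A conjugation \<open>C\<close> as in the theorem would contradict this asymmetry.
  Being an involution, it satisfies \<open>M_zbar = C \<circ> M_z \<circ> C\<close>, and each of the three factors maps
  \<^const>\<open>H2\<close> into itself. Hence \<^const>\<open>M_zbar\<close> would do so too, whereas for \<open>x \<noteq> 0\<close> it maps the constant
  function \<open>x\<close>, which lies in \<^const>\<open>H2\<close>, to a function whose coefficient at \<open>-1\<close> is \<open>x\<close>.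

  The only analytic ingredient is that the characters \<open>z\<^sup>n\<close> with \<open>n \<noteq> 0\<close> have mean zero on the
  circle (\<open>integral_circle_cnj_powi\<close>), which identifies the Fourier coefficients of a constant.\<close>

lemma finite_measure_circle: "finite_measure circle"
  by (rule finite_measureI) (simp add: emeasure_space_circle)

lemma lebesgue_integral_circle:
  fixes g :: "complex \<Rightarrow> complex"
  assumes "g \<in> borel_measurable circle"
  shows "(\<integral>z. g z \<partial>circle) =
    (\<integral>t. indicator {0..<2 * pi} t *\<^sub>R g (cis t) \<partial>lborel) / (2 * pi)"
proof -
  have [measurable]: "cis \<in> borel_measurable borel"
    by (intro borel_measurable_continuous_onI continuous_intros)
  have cis [measurable]: "cis \<in> measurable lborel (restrict_space borel (sphere 0 1))"
    by (rule measurable_restrict_space2) auto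
  have g [measurable]: "g \<in> borel_measurable (restrict_space borel (sphere 0 1))"
    using assms by (simp add: measurable_cong_sets[OF sets_circle refl])
  have "(\<integral>z. g z \<partial>circle) = (\<integral>t. g (cis t) \<partial>uniform_measure lborel {0..<2 * pi})"
    unfolding circle_def by (rule integral_distr) measurable
  also have "\<dots> = (\<integral>t. (indicator {0..<2 * pi} t / (2 * pi)) *\<^sub>R g (cis t) \<partial>lborel)"
  proof -
    have "uniform_measure lborel {0..<2 * pi}
        = density lborel (\<lambda>t. ennreal (indicator {0..<2 * pi} t / (2 * pi)))"
      unfolding uniform_measure_def
      by (rule arg_cong[where f = "density lborel"])
         (auto simp: fun_eq_iff indicator_def divide_ennreal ennreal_1[symmetric]
           simp del: ennreal_1)
    then show ?thesis by (simp add: integral_density)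
  qed
  also have "\<dots> = (\<integral>t. (indicator {0..<2 * pi} t *\<^sub>R g (cis t)) / (2 * pi) \<partial>lborel)"
    by (intro Bochner_Integration.integral_cong) (auto simp: scaleR_conv_of_real)
  finally show ?thesis by simp
qed

lemma integral_circle_cnj_powi:
  fixes n :: int
  shows "(\<integral>z. cnj (z powi n) \<partial>circle) = (if n = 0 then 1 else 0)"
proof (cases "n = 0")
  case True
  then show ?thesis by (simp add: measure_def emeasure_space_circle)
next
  case False
  \<comment> \<open>an antiderivative of the integrand in the angle; it takes the same value at both ends\<close>
  define F where "F t = cis (- (real_of_int n * t)) * (\<i> / of_int n)" for t
  have [measurable]: "(\<lambda>t. cis (- (real_of_int n * t))) \<in> borel_measurable borel"
    by (intro borel_measurable_continuous_onI continuous_intros)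
  have "(\<integral>t. indicator {0..<2 * pi} t *\<^sub>R cnj (cis t powi n) \<partial>lborel)
      = (\<integral>t. indicator {0..2 * pi} t *\<^sub>R cis (- (real_of_int n * t)) \<partial>lborel)"
  proof (rule integral_cong_AE)
    show "AE t in lborel. indicator {0..<2 * pi} t *\<^sub>R cnj (cis t powi n)
        = indicator {0..2 * pi} t *\<^sub>R cis (- (real_of_int n * t))"
      using AE_lborel_singleton[of "2 * pi"]
      by eventually_elim (auto simp: indicator_def cis_power_int cis_cnj)
  qed (simp_all add: cis_power_int cis_cnj del: complex_cnj_power_int)
  also have "\<dots> = F (2 * pi) - F 0"
  proof (rule integral_FTC_Icc)
    show "(F has_vector_derivative cis (- (real_of_int n * t))) (at t within {0..2 * pi})" for t
      unfolding F_def using False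
      by (auto intro!: derivative_eq_intros
          simp: has_vector_derivative_def scaleR_conv_of_real mult_ac)
  qed (auto intro!: continuous_intros)
  also have "\<dots> = 0"
    using cis_multiple_2pi[of "of_int (- n)"] by (simp add: F_def mult_ac)
  finally show ?thesis
    using False by (subst lebesgue_integral_circle) (simp_all del: complex_cnj_power_int integral_cnj)
qed

lift_definition const_L2 :: "'h::{complex_hilbert, second_countable_topology} \<Rightarrow> 'h L2" is "\<lambda>x z. x"
  by (simp add: L2_rel_def square_integrable_def finite_measure.integrable_const[OF finite_measure_circle])

lemma fourier_coeff_const_L2: "fourier_coeff (const_L2 x) n = (if n = 0 then x else 0)"
proof transfer
  fix x :: 'a and n :: int
  have "integrable circle (\<lambda>z. cnj (z powi n))"
    by (rule finite_measure.integrable_const_bound[OF finite_measure_circle, where B = 1])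
       (auto simp: space_circle norm_power_int simp del: complex_cnj_power_int)
  then have "(\<integral>z. cnj (z powi n) *\<^sub>C x \<partial>circle) = (\<integral>z. cnj (z powi n) \<partial>circle) *\<^sub>C x"
    by (rule integral_bounded_linear
        [OF bounded_bilinear.bounded_linear_left[OF bounded_bilinear_scaleC]])
  also have "\<dots> = (if n = 0 then x else 0)"
    unfolding integral_circle_cnj_powi using scaleC_of_real[of 0 x] by simp
  finally show "(\<integral>z. cnj (z powi n) *\<^sub>C x \<partial>circle) = (if n = 0 then x else 0)" .
qed

lemma const_L2_in_H2: "const_L2 x \<in> H2"
  by (simp add: H2_def fourier_coeff_const_L2)

text \<open>On the circle \<open>z\<close> and its conjugate are inverse to each other, so either factor is absorbed into
  the exponent of the character under the integral.\<close>

lemma fourier_coeff_M_z: "fourier_coeff (M_z f) n = fourier_coeff f (n - 1)"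
proof transfer
  fix f :: "complex \<Rightarrow> 'a" and n :: int
  have "cnj (z powi n) * z = cnj (z powi (n - 1))" if "z \<in> space circle" for z
  proof -
    have "z \<noteq> 0" "z * cnj z = 1"
      using that by (auto simp: space_circle complex_norm_square[symmetric])
    then show ?thesis
      by (simp add: power_int_diff field_simps)
  qed
  then show "(\<integral>z. cnj (z powi n) *\<^sub>C z *\<^sub>C f z \<partial>circle) = (\<integral>z. cnj (z powi (n - 1)) *\<^sub>C f z \<partial>circle)"
    by (intro Bochner_Integration.integral_cong)
       (auto simp: scaleC_scaleC simp del: complex_cnj_power_int)
qed

lemma fourier_coeff_M_zbar: "fourier_coeff (M_zbar f) n = fourier_coeff f (n + 1)"
proof transfer
  fix f :: "complex \<Rightarrow> 'a" and n :: int
  have "cnj (z powi n) * cnj z = cnj (z powi (n + 1))" if "z \<in> space circle" for z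
    using that by (subst power_int_add_1) (auto simp: space_circle)
  then show "(\<integral>z. cnj (z powi n) *\<^sub>C cnj z *\<^sub>C f z \<partial>circle) = (\<integral>z. cnj (z powi (n + 1)) *\<^sub>C f z \<partial>circle)"
    by (intro Bochner_Integration.integral_cong)
       (auto simp: scaleC_scaleC simp del: complex_cnj_power_int)
qed

lemma M_z_in_H2: "f \<in> H2 \<Longrightarrow> M_z f \<in> H2"
  by (simp add: H2_def fourier_coeff_M_z)

theorem proposition5p5:
  assumes "\<exists>x :: 'h::{complex_hilbert, second_countable_topology}. x \<noteq> 0"
  shows "\<not> (\<exists>C :: 'h L2 \<Rightarrow> 'h L2.
    conjugation C \<and> C \<circ> M_z = M_zbar \<circ> C \<and> C ` H2 \<subseteq> H2)"
proof
  assume "\<exists>C :: 'h L2 \<Rightarrow> 'h L2. conjugation C \<and> C \<circ> M_z = M_zbar \<circ> C \<and> C ` H2 \<subseteq> H2"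
  then obtain C :: "'h L2 \<Rightarrow> 'h L2"
    where C: "conjugation C" "C \<circ> M_z = M_zbar \<circ> C" "C ` H2 \<subseteq> H2" by blast
  have invol: "C (C f) = f" for f
    using C(1) by (simp add: conjugation_def)
  have intertwine: "C (M_z f) = M_zbar (C f)" for f
    using fun_cong[OF C(2), of f] by simp
  have invariant: "C f \<in> H2" if "f \<in> H2" for f
    using C(3) that by blast
  obtain x :: 'h where "x \<noteq> 0" using assms by blast
  have "C (M_z (C (const_L2 x))) \<in> H2"
    by (intro invariant M_z_in_H2 const_L2_in_H2)
  then have "M_zbar (const_L2 x) \<in> H2"
    by (simp add: intertwine invol)
  then have "fourier_coeff (M_zbar (const_L2 x)) (-1) = 0"
    by (simp add: H2_def)
  with \<open>x \<noteq> 0\<close> show False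
    by (simp add: fourier_coeff_M_zbar fourier_coeff_const_L2)
qed

end
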